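(* Let $S\subseteq[n]$ and $k\in S$. Fix deterministic vectors $\delta_j\in\mathbb{R}^n$ for $j\in S\setminus\{k\}$ and $\delta_j=0$ for $j\notin S$. Suppose agent $k$ regards $M$ as random with distribution $\mathcal{D}_k$ having finite first and second moments, and evaluates a report $\delta_k\in\mathbb{R}^n$ by $\mathbb{E}_{M\sim\mathcal{D}_k}\big[-\langle\delta_k,w_k'\rangle+\gamma_k\langle w_k',\Sigma w_k'\rangle\big]$, where $w_k'=W'e_k$ and $(W',P')$ is the stable point for $M+\Delta$ with $\Delta e_i=\delta_i$ for all $i$. Let $V_k\in\mathbb{R}^{n\times n}$ be defined by $\mathrm{vec}(V_k)=\tfrac12K^{-1}\mathrm{vec}\big(\mathbb{E}_{\mathcal{D}_k}[M]+\mathbb{E}_{\mathcal{D}_k}[M]^T\big)$ and $v_k=V_ke_k$. Then $\delta_k$ maximizes this expected utility if and only if $$T^{(k,k)}\delta_k+\sum_{j\in S,\ j\neq k}T^{(k,j)}\delta_j=\big(2\gamma_k(L^{(k,k)})^T\Sigma-I\big)v_k .$$ Consequently, a matrix $\Delta$ with $\Delta e_j=0$ for $j\notin S$ is a Nash equilibrium (each $k\in S$ maximizing its expected utility above given the others' columns) if and only if these equations hold simultaneously for all $k\in S$; if the joint system has no solution, there is no Nash equilibrium.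
   Context: Fix agents $[n]=\{1,\dots,n\}$. Let $\Sigma\in\mathbb{R}^{n\times n}$ be symmetric positive definite and $\Gamma=\mathrm{diag}(\gamma_1,\dots,\gamma_n)$ with all $\gamma_i>0$. For a matrix of reported negotiating positions $M'\in\mathbb{R}^{n\times n}$, the stable point for $M'$ is the unique pair $(W,P)$ of real $n\times n$ matrices with $W=W^T$, $P^T=-P$ and $M'-P=2\Sigma W\Gamma$; equivalently $\mathrm{vec}(W)=\tfrac12(\Gamma\otimes\Sigma+\Sigma\otimes\Gamma)^{-1}\mathrm{vec}(M'+M'^T)$. Here $\mathrm{vec}$ stacks columns and $e_i$ is the $i$-th standard basis vector. Matrices: $\Pi\in\mathbb{R}^{n^2\times n^2}$ is the commutation matrix, $\Pi\,\mathrm{vec}(X)=\mathrm{vec}(X^T)$. For $Z\in\mathbb{R}^{n^2\times n^2}$, $Z^{(p,q)}$ is its $n\times n$ block in block-row $p$ and block-column $q$. Set $K=\Gamma\otimes\Sigma+\Sigma\otimes\Gamma$, $L=\tfrac12(K^{-1}+K^{-1}\Pi)$, $T^{(k,k)}=L^{(k,k)}+(L^{(k,k)})^T-2\gamma_k(L^{(k,k)})^T\Sigma L^{(k,k)}$, and $T^{(k,j)}=(I-2\gamma_k(L^{(k,k)})^T\Sigma)L^{(k,j)}$ for $j\neq k$. *)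

theory Defs
  imports "HOL-Probability.Probability"
begin

text \<open>Agents are the elements of a finite type 'n (so n = CARD('n)).
 n x n matrices are real^'n::finite^'n (X $ i $ j = entry in row i, column j).
 n^2-vectors/matrices are indexed by pairs ('n \<times> 'n): the pair (i,j) stands for
 the position of entry X_ij in the column-stacking vec(X), i.e. position (j-1)n+i.
 Hence the block Z^(p,q) consists of the entries Z_((a,p),(b,q)).\<close>

definition vecM :: "real^'n::finite^'n \<Rightarrow> real^('n \<times> 'n)" where
  "vecM X = (\<chi> ij. X $ fst ij $ snd ij)"

definition unvecM :: "real^('n \<times> 'n) \<Rightarrow> real^'n::finite^'n" where
  "unvecM v = (\<chi> i j. v $ (i, j))"

definition kron :: "real^'n::finite^'n \<Rightarrow> real^'n^'n \<Rightarrow> real^('n \<times> 'n)^('n \<times> 'n)" where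
  "kron A B = (\<chi> r c. A $ snd r $ snd c * B $ fst r $ fst c)"

text \<open>Commutation matrix: Pi vec(X) = vec(X^T).\<close>
definition commutation :: "real^('n::finite \<times> 'n)^('n \<times> 'n)" where
  "commutation = (\<chi> r c. if c = (snd r, fst r) then 1 else 0)"

definition blockM :: "real^('n \<times> 'n)^('n \<times> 'n) \<Rightarrow> 'n \<Rightarrow> 'n \<Rightarrow> real^'n::finite^'n" where
  "blockM Z p q = (\<chi> a b. Z $ (a, p) $ (b, q))"

definition diagM :: "real^'n \<Rightarrow> real^'n::finite^'n" where
  "diagM g = (\<chi> i j. if i = j then g $ i else 0)"

definition col :: "real^'n::finite^'n \<Rightarrow> 'n \<Rightarrow> real^'n" where
  "col X k = (\<chi> a. X $ a $ k)"

definition colsM :: "('n \<Rightarrow> real^'n) \<Rightarrow> real^'n::finite^'n" where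
  "colsM d = (\<chi> a i. d i $ a)"

definition pos_def_sym :: "real^'n::finite^'n \<Rightarrow> bool" where
  "pos_def_sym A \<longleftrightarrow> transpose A = A \<and> (\<forall>x. x \<noteq> 0 \<longrightarrow> x \<bullet> (A *v x) > 0)"

definition stable_point :: "real^'n::finite^'n \<Rightarrow> real^'n \<Rightarrow> real^'n^'n \<Rightarrow> (real^'n^'n) \<times> (real^'n^'n)" where
  "stable_point Sig g M' = (THE (W, P). transpose W = W \<and> transpose P = - P \<and>
       M' - P = 2 *\<^sub>R (Sig ** W ** diagM g))"

definition Kmat :: "real^'n::finite^'n \<Rightarrow> real^'n \<Rightarrow> real^('n \<times> 'n)^('n \<times> 'n)" where
  "Kmat Sig g = kron (diagM g) Sig + kron Sig (diagM g)"

definition Lmat :: "real^'n::finite^'n \<Rightarrow> real^'n \<Rightarrow> real^('n \<times> 'n)^('n \<times> 'n)" where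
  "Lmat Sig g = (1/2) *\<^sub>R (matrix_inv (Kmat Sig g) + matrix_inv (Kmat Sig g) ** commutation)"

definition Tblk :: "real^'n::finite^'n \<Rightarrow> real^'n \<Rightarrow> 'n \<Rightarrow> 'n \<Rightarrow> real^'n^'n" where
  "Tblk Sig g k j = (let Lkk = blockM (Lmat Sig g) k k in
     if j = k then Lkk + transpose Lkk - (2 * g $ k) *\<^sub>R (transpose Lkk ** Sig ** Lkk)
     else (mat 1 - (2 * g $ k) *\<^sub>R (transpose Lkk ** Sig)) ** blockM (Lmat Sig g) k j)"

definition exp_utility ::
  "real^'n::finite^'n \<Rightarrow> real^'n \<Rightarrow> (real^'n^'n) measure \<Rightarrow> 'n \<Rightarrow> ('n \<Rightarrow> real^'n) \<Rightarrow> real^'n \<Rightarrow> real" where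
  "exp_utility Sig g D k delta d =
     (\<integral>M. (let w = col (fst (stable_point Sig g (M + colsM (delta(k := d))))) k in
            - (d \<bullet> w) + g $ k * (w \<bullet> (Sig *v w))) \<partial>D)"

definition best_response ::
  "real^'n::finite^'n \<Rightarrow> real^'n \<Rightarrow> (real^'n^'n) measure \<Rightarrow> 'n \<Rightarrow> ('n \<Rightarrow> real^'n) \<Rightarrow> real^'n \<Rightarrow> bool" where
  "best_response Sig g D k delta d \<longleftrightarrow>
     (\<forall>d'. exp_utility Sig g D k delta d' \<le> exp_utility Sig g D k delta d)"

definition nash_eq ::
  "real^'n::finite^'n \<Rightarrow> real^'n \<Rightarrow> ('n \<Rightarrow> (real^'n^'n) measure) \<Rightarrow> 'n set \<Rightarrow> real^'n^'n \<Rightarrow> bool" where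
  "nash_eq Sig g D S Delta \<longleftrightarrow>
     (\<forall>k\<in>S. best_response Sig g (D k) k (col Delta) (col Delta k))"

definition Vmat :: "real^'n::finite^'n \<Rightarrow> real^'n \<Rightarrow> (real^'n^'n) measure \<Rightarrow> real^'n^'n" where
  "Vmat Sig g D = (let EM = (\<integral>M. M \<partial>D) in
     unvecM ((1/2) *\<^sub>R (matrix_inv (Kmat Sig g) *v vecM (EM + transpose EM))))"

definition fo_condition ::
  "real^'n::finite^'n \<Rightarrow> real^'n \<Rightarrow> (real^'n^'n) measure \<Rightarrow> 'n set \<Rightarrow> 'n \<Rightarrow> ('n \<Rightarrow> real^'n) \<Rightarrow> bool" where
  "fo_condition Sig g D S k delta \<longleftrightarrow>
     Tblk Sig g k k *v delta k + (\<Sum>j\<in>S - {k}. Tblk Sig g k j *v delta j)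
     = ((2 * g $ k) *\<^sub>R (transpose (blockM (Lmat Sig g) k k) ** Sig) - mat 1)
         *v col (Vmat Sig g D) k"

end

theory Submission
  imports Defs
begin

text \<open>The stable point depends linearly on the reported matrix: symmetrizing
  \<open>M' - P = 2 \<Sigma> W \<Gamma>\<close> eliminates \<open>P\<close> and leaves \<open>K vec W = vec (M' + M'\<^sup>T) / 2\<close>, where \<open>K\<close> is
  positive definite. So \<open>w\<^sub>k'\<close> is affine in \<open>\<delta>\<^sub>k\<close> with linear part \<open>A = L\<^sup>(\<^sup>k\<^sup>,\<^sup>k\<^sup>)\<close>, and the expected
  utility is quadratic with Hessian \<open>- T\<^sup>(\<^sup>k\<^sup>,\<^sup>k\<^sup>)\<close>. It is concave: if \<open>W\<close> is the stable point for the
  matrix with \<open>k\<close>-th column \<open>h\<close> and zero elsewhere, pairing \<open>W\<close> with the stable point equation gives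
  \<open>\<langle>h, A h\<rangle> = 2 \<Sum>\<^sub>j \<gamma>\<^sub>j \<langle>w\<^sub>j, \<Sigma> w\<^sub>j\<rangle> \<ge> 2 \<gamma>\<^sub>k \<langle>A h, \<Sigma> A h\<rangle>\<close>. A concave quadratic is maximal exactly where
  its gradient vanishes, and this is the stated equation.\<close>

section \<open>Vectorization, Kronecker products and the Frobenius inner product\<close>

lemma transpose_add: "transpose (A + B) = transpose A + transpose (B :: real^'n^'m)"
  by (simp add: transpose_def vec_eq_iff)

lemma transpose_diagM [simp]: "transpose (diagM g) = diagM g"
  by (auto simp: transpose_def diagM_def vec_eq_iff)

lemma unvecM_vecM [simp]: "unvecM (vecM X) = X"
  by (simp add: unvecM_def vecM_def vec_eq_iff)

lemma vecM_unvecM [simp]: "vecM (unvecM v) = v"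
  by (simp add: unvecM_def vecM_def vec_eq_iff)

lemma linear_vecM: "linear vecM"
  by (rule linearI) (simp_all add: vecM_def vec_eq_iff)

lemma linear_unvecM: "linear unvecM"
  by (rule linearI) (simp_all add: unvecM_def vec_eq_iff)

lemma linear_col: "linear (\<lambda>X. col X k)"
  by (rule linearI) (simp_all add: col_def vec_eq_iff)

lemma col_colsM [simp]: "col (colsM d) = d"
  by (simp add: fun_eq_iff col_def colsM_def vec_eq_iff)

lemma sum_UNIV_pair:
  "(\<Sum>r\<in>UNIV. f r) = (\<Sum>b\<in>UNIV. \<Sum>a\<in>UNIV. f (a :: 'a::finite, b :: 'b::finite))"
  by (subst sum.swap) (simp add: sum.cartesian_product UNIV_Times_UNIV)

lemma kron_vecM: "kron A B *v vecM X = vecM (B ** X ** transpose A)"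
  by (simp add: kron_def vecM_def matrix_vector_mult_def matrix_matrix_mult_def transpose_def
      vec_eq_iff sum_UNIV_pair sum_distrib_left sum_distrib_right mult_ac)

lemma commutation_vecM: "commutation *v vecM X = vecM (transpose X)"
proof -
  have "(\<Sum>c\<in>UNIV. (if c = (j, i) then 1 else 0) * X $ fst c $ snd c) = X $ j $ i" for i j
    by (simp add: if_distrib[of "\<lambda>t. t * _"] cong: if_cong)
  then show ?thesis
    by (simp add: commutation_def vecM_def matrix_vector_mult_def transpose_def vec_eq_iff)
qed

lemma
  assumes "invertible (M :: real^'n^'m)"
  shows matrix_inv_left: "matrix_inv M ** M = mat 1"
    and matrix_inv_right: "M ** matrix_inv M = mat 1"
  using someI_ex[OF assms[unfolded invertible_def]] by (auto simp: matrix_inv_def)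

lemma mult_diagM: "(A ** diagM g) $ i $ j = A $ i $ j * g $ j"
  by (simp add: matrix_matrix_mult_def diagM_def if_distrib[of "\<lambda>t. _ * t"] cong: if_cong)

text \<open>Right multiplication by \<open>diagM g\<close> only rescales columns, so the Frobenius
  pairing decouples into weighted \<open>Sig\<close>-energies of the columns. Both the positivity of
  \<open>Kmat\<close> and \<open>block_energy\<close> rest on this.\<close>

lemma inner_mult_diagM:
  "X \<bullet> (Sig ** Y ** diagM g) = (\<Sum>j\<in>UNIV. g $ j * (col X j \<bullet> (Sig *v col Y j)))"
proof -
  have "X \<bullet> (Sig ** Y ** diagM g)
      = (\<Sum>i\<in>UNIV. \<Sum>j\<in>UNIV. X $ i $ j * ((Sig ** Y) $ i $ j * g $ j))"
    by (simp add: inner_vec_def mult_diagM)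
  also have "\<dots> = (\<Sum>j\<in>UNIV. \<Sum>i\<in>UNIV. X $ i $ j * ((Sig ** Y) $ i $ j * g $ j))"
    by (rule sum.swap)
  also have "\<dots> = (\<Sum>j\<in>UNIV. g $ j * (col X j \<bullet> (Sig *v col Y j)))"
    by (simp add: inner_vec_def col_def matrix_matrix_mult_def matrix_vector_mult_def
        sum_distrib_left mult_ac)
  finally show ?thesis .
qed

lemma inner_transpose: "transpose X \<bullet> transpose Y = X \<bullet> (Y :: real^'n^'m)"
  by (simp add: inner_vec_def transpose_def) (rule sum.swap)

text \<open>Transposing both arguments preserves the pairing but here flips its sign.\<close>

lemma inner_skew_eq_0:
  fixes W P :: "real^'n^'n"
  assumes "transpose W = W" "transpose P = - P"
  shows "W \<bullet> P = 0"
  using inner_transpose[of W P] assms by simp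

lemma quadratic_max_iff:
  fixes f Q :: "'a::real_inner \<Rightarrow> real"
  assumes expand: "\<And>h. f (d + h) = f d + G \<bullet> h - Q h"
    and nonneg: "\<And>h. 0 \<le> Q h" and scale: "\<And>c h. Q (c *\<^sub>R h) = c\<^sup>2 * Q h"
  shows "(\<forall>d'. f d' \<le> f d) \<longleftrightarrow> G = 0"
proof
  assume max: "\<forall>d'. f d' \<le> f d"
  have bound: "c * (G \<bullet> G) \<le> c\<^sup>2 * Q G" for c
    using max[rule_format, of "d + c *\<^sub>R G"] by (simp add: expand scale)
  \<comment> \<open>A step of length c along \<open>G\<close> gains at first order and loses only at
    second order; dividing by c and letting c tend to 0 from the right forces \<open>G\<close> to
    vanish.\<close>
  have "G \<bullet> G \<le> c * Q G" if "0 < c" for c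
    using bound[of c] that by (simp add: power2_eq_square mult.assoc)
  then have "\<forall>\<^sub>F c in at_right 0. G \<bullet> G \<le> c * Q G"
    by (auto simp: eventually_at_right_less intro: eventually_at_rightI[of 0 1])
  moreover have "((\<lambda>c. c * Q G) \<longlongrightarrow> 0 * Q G) (at_right 0)"
    by (intro tendsto_intros)
  ultimately have "G \<bullet> G \<le> 0"
    using tendsto_lowerbound[of "\<lambda>c. c * Q G" 0 "at_right 0" "G \<bullet> G"] by simp
  then show "G = 0" by (metis antisym inner_eq_zero_iff inner_ge_zero)
next
  assume "G = 0"
  show "\<forall>d'. f d' \<le> f d"
  proof
    fix d'
    show "f d' \<le> f d"
      using expand[of "d' - d"] nonneg[of "d' - d"] \<open>G = 0\<close> by simp
  qed
qed

text \<open>Linear maps in finite dimension are bounded, so the integrand is dominated by a multiple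
  of the squared norm.\<close>

lemma integrable_quadratic:
  fixes u :: "'a::euclidean_space \<Rightarrow> 'b::euclidean_space" and B :: "'b \<Rightarrow> 'c::euclidean_space"
  assumes D: "sets D = sets borel" and mom2: "integrable D (\<lambda>M. (norm M)\<^sup>2)"
    and u: "linear u" and B: "linear B" and v: "linear v"
  shows "integrable D (\<lambda>M. v M \<bullet> B (u M))"
proof -
  have bu: "linear (\<lambda>M. B (u M))" using linear_compose[OF u B] by (simp add: o_def)
  obtain c where c: "\<And>M. norm (B (u M)) \<le> norm M * c" "0 < c"
    using bounded_linear.pos_bounded[OF linear_conv_bounded_linear[THEN iffD1, OF bu]] by auto
  obtain c' where c': "\<And>M. norm (v M) \<le> norm M * c'" "0 < c'"
    using bounded_linear.pos_bounded[OF linear_conv_bounded_linear[THEN iffD1, OF v]] by auto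
  have meas: "(\<lambda>M. v M \<bullet> B (u M)) \<in> borel_measurable D"
    unfolding measurable_cong_sets[OF D refl]
    by (intro borel_measurable_continuous_onI continuous_intros
        linear_continuous_on linear_conv_bounded_linear[THEN iffD1] bu v)
  show ?thesis
  proof (rule Bochner_Integration.integrable_bound)
    show "integrable D (\<lambda>M. (c' * c) * (norm M)\<^sup>2)" using mom2 by simp
    have "norm (v M \<bullet> B (u M)) \<le> norm (c' * c * (norm M)\<^sup>2)" for M
    proof -
      have "norm (v M \<bullet> B (u M)) \<le> norm (v M) * norm (B (u M))"
        by (simp add: Cauchy_Schwarz_ineq2)
      also have "\<dots> \<le> (norm M * c') * (norm M * c)"
        using c c' by (intro mult_mono) (auto intro: mult_nonneg_nonneg)
      finally show ?thesis using c c' by (simp add: power2_eq_square mult_ac)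
    qed
    then show "AE M in D. norm (v M \<bullet> B (u M)) \<le> norm (c' * c * (norm M)\<^sup>2)" by simp
  qed (use meas in simp)
qed

section \<open>The closed-form solution as a linear map of the report\<close>

definition stable_W :: "real^'n::finite^'n \<Rightarrow> real^'n \<Rightarrow> real^'n^'n \<Rightarrow> real^'n^'n" where
  "stable_W Sig g M = unvecM ((1/2) *\<^sub>R (matrix_inv (Kmat Sig g) *v vecM (M + transpose M)))"

lemma Vmat_eq: "Vmat Sig g D = stable_W Sig g (\<integral>M. M \<partial>D)"
  by (simp add: Vmat_def stable_W_def Let_def)

lemma linear_stable_W: "linear (stable_W Sig g)"
proof -
  have "linear (\<lambda>M::real^'n^'n. M + transpose M)"
    by (rule linearI) (simp_all add: transpose_def vec_eq_iff algebra_simps)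
  from linear_compose[OF linear_compose[OF this linear_vecM]
      linear_compose[OF linear_compose[OF matrix_vector_mul_linear linear_scale_self] linear_unvecM]]
  show ?thesis by (simp add: stable_W_def[abs_def] o_def)
qed

text \<open>The summand with \<open>commutation\<close> in \<open>Lmat\<close> produces the
  contribution of \<open>transpose M\<close>, so \<open>Lmat\<close> is the matrix of
  \<open>stable_W\<close> in vectorized coordinates. Its blocks therefore measure how each reported
  column moves each column of W.\<close>

lemma Lmat_vecM: "Lmat Sig g *v vecM M = vecM (stable_W Sig g M)"
  by (simp add: Lmat_def stable_W_def scaleR_matrix_vector_assoc[symmetric]
      matrix_vector_mult_add_rdistrib matrix_vector_mul_assoc[symmetric] commutation_vecM
      linear_add[OF linear_vecM] matrix_vector_right_distrib)

lemma col_stable_W: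
  "col (stable_W Sig g M) k = (\<Sum>j\<in>UNIV. blockM (Lmat Sig g) k j *v col M j)"
proof -
  have "stable_W Sig g M = unvecM (Lmat Sig g *v vecM M)"
    by (simp add: Lmat_vecM)
  then show ?thesis
    by (simp add: vec_eq_iff col_def unvecM_def blockM_def matrix_vector_mult_def vecM_def
        sum_UNIV_pair)
qed

section \<open>Existence and uniqueness of the stable point\<close>

locale market =
  fixes Sig :: "real^'n^'n" and g :: "real^'n"
  assumes Sig: "pos_def_sym Sig" and g_pos: "\<And>i. 0 < g $ i"
begin

lemma Sig_sym [simp]: "transpose Sig = Sig"
  using Sig by (simp add: pos_def_sym_def)

lemma Sig_commute: "x \<bullet> (Sig *v y) = y \<bullet> (Sig *v x)"
  by (metis Sig_sym dot_lmul_matrix inner_commute transpose_matrix_vector)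

lemma Sig_nonneg: "0 \<le> x \<bullet> (Sig *v x)"
  using Sig by (cases "x = 0") (auto simp: pos_def_sym_def intro: less_imp_le)

text \<open>The second term is \<open>\<Gamma> X \<Sigma>\<close>, written so that \<open>inner_mult_diagM\<close> applies to \<open>X\<^sup>T\<close>.\<close>
lemma Kmat_vecM:
  "Kmat Sig g *v vecM X = vecM (Sig ** X ** diagM g + transpose (Sig ** transpose X ** diagM g))"
  by (simp add: Kmat_def matrix_vector_mult_add_rdistrib kron_vecM linear_add[OF linear_vecM]
      matrix_transpose_mul matrix_mul_assoc)

lemma inner_weighted_nonneg: "0 \<le> X \<bullet> (Sig ** X ** diagM g)"
  unfolding inner_mult_diagM
  by (intro sum_nonneg mult_nonneg_nonneg Sig_nonneg less_imp_le g_pos)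

text \<open>Pairing K vec(X) with vec(X) gives the energies of X and of its transpose. Both are
  nonnegative, so on the kernel the first one vanishes, and positive definiteness of
  \<open>Sig\<close> kills every column of X.\<close>

lemma invertible_Kmat: "invertible (Kmat Sig g)"
proof -
  have "v = 0" if "Kmat Sig g *v v = 0" for v
  proof -
    define X where "X = unvecM v"
    have "vecM (Sig ** X ** diagM g + transpose (Sig ** transpose X ** diagM g)) = 0"
      using that Kmat_vecM[of X] by (simp add: X_def)
    then have "Sig ** X ** diagM g + transpose (Sig ** transpose X ** diagM g) = 0"
      by (metis linear_0[OF linear_unvecM] unvecM_vecM)
    then have "X \<bullet> (Sig ** X ** diagM g) + X \<bullet> transpose (Sig ** transpose X ** diagM g) = 0"
      by (metis inner_add_right inner_zero_right)
    moreover have "0 \<le> X \<bullet> transpose (Sig ** transpose X ** diagM g)"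
      using inner_weighted_nonneg[of "transpose X"]
      by (metis inner_transpose transpose_transpose)
    ultimately have "X \<bullet> (Sig ** X ** diagM g) = 0"
      using inner_weighted_nonneg[of X] by linarith
    then have "g $ j * (col X j \<bullet> (Sig *v col X j)) = 0" for j
      unfolding inner_mult_diagM
      by (subst (asm) sum_nonneg_eq_0_iff)
        (auto intro!: mult_nonneg_nonneg Sig_nonneg less_imp_le[OF g_pos])
    then have "col X j \<bullet> (Sig *v col X j) = 0" for j
      using g_pos[of j] by (metis less_irrefl mult_eq_0_iff)
    then have "col X j = 0" for j
      using Sig by (metis less_irrefl pos_def_sym_def)
    then have "X = 0" by (simp add: col_def vec_eq_iff)
    then show "v = 0"
      by (metis X_def linear_0[OF linear_vecM] vecM_unvecM)
  qed
  then show ?thesis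
    by (simp add: invertible_left_inverse matrix_left_invertible_ker)
qed

text \<open>No symmetry of X is assumed: this lets \<open>transpose_stable_W\<close> apply the lemma
  to the transposed solution.\<close>

lemma stable_W_unique:
  assumes "Sig ** X ** diagM g + transpose (Sig ** transpose X ** diagM g)
    = (1/2) *\<^sub>R (M + transpose M)"
  shows "X = stable_W Sig g M"
proof -
  have "vecM X = matrix_inv (Kmat Sig g) *v (Kmat Sig g *v vecM X)"
    using matrix_inv_left[OF invertible_Kmat] by (simp add: matrix_vector_mul_assoc)
  also have "\<dots> = vecM (stable_W Sig g M)"
    by (simp add: Kmat_vecM assms linear_cmul[OF linear_vecM] stable_W_def matrix_vector_mult_scaleR)
  finally show ?thesis by (metis unvecM_vecM)
qed

lemma stable_W_eq:
  "Sig ** stable_W Sig g M ** diagM g + transpose (Sig ** transpose (stable_W Sig g M) ** diagM g)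
    = (1/2) *\<^sub>R (M + transpose M)"
proof -
  let ?W = "stable_W Sig g M"
  have "Kmat Sig g *v vecM ?W
      = (1/2) *\<^sub>R ((Kmat Sig g ** matrix_inv (Kmat Sig g)) *v vecM (M + transpose M))"
    by (simp add: stable_W_def matrix_vector_mult_scaleR matrix_vector_mul_assoc)
  also have "\<dots> = vecM ((1/2) *\<^sub>R (M + transpose M))"
    using matrix_inv_right[OF invertible_Kmat] by (simp add: linear_cmul[OF linear_vecM])
  finally show ?thesis
    unfolding Kmat_vecM by (metis unvecM_vecM)
qed

text \<open>Transposition swaps the two terms on the left of \<open>stable_W_eq\<close> and fixes
  the right side, so the transpose solves the same equation.\<close>

lemma transpose_stable_W: "transpose (stable_W Sig g M) = stable_W Sig g M"
proof (rule stable_W_unique)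
  let ?W = "stable_W Sig g M"
  have "transpose (Sig ** ?W ** diagM g) + Sig ** transpose ?W ** diagM g
      = transpose (Sig ** ?W ** diagM g + transpose (Sig ** transpose ?W ** diagM g))"
    by (simp add: transpose_add)
  also have "\<dots> = (1/2) *\<^sub>R (M + transpose M)"
    unfolding stable_W_eq by (simp add: transpose_add transpose_scalar add.commute)
  finally show "Sig ** transpose ?W ** diagM g + transpose (Sig ** transpose (transpose ?W) ** diagM g)
      = (1/2) *\<^sub>R (M + transpose M)"
    by (simp add: add.commute)
qed

lemma stable_W_sym_eq:
  defines "Y \<equiv> \<lambda>M. Sig ** stable_W Sig g M ** diagM g"
  shows "2 *\<^sub>R Y M + 2 *\<^sub>R transpose (Y M) = M + transpose M"
proof -
  have "Y M + transpose (Y M) = (1/2) *\<^sub>R (M + transpose M)"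
    using stable_W_eq[of M] by (simp add: Y_def transpose_stable_W)
  then have "2 *\<^sub>R (Y M + transpose (Y M)) = 2 *\<^sub>R ((1/2) *\<^sub>R (M + transpose M))"
    by (rule arg_cong)
  then show ?thesis by (simp add: scaleR_add_right)
qed

lemma skew_remainder:
  fixes M :: "real^'n^'n"
  defines "P \<equiv> M - 2 *\<^sub>R (Sig ** stable_W Sig g M ** diagM g)"
  shows "transpose P = - P"
proof -
  define Y where "Y = Sig ** stable_W Sig g M ** diagM g"
  have "transpose P $ i $ j = (- P) $ i $ j" for i j
    using arg_cong[OF stable_W_sym_eq[of M, folded Y_def], of "\<lambda>X. X $ i $ j"]
    by (simp add: P_def Y_def[symmetric] transpose_def)
  then show ?thesis by (simp add: vec_eq_iff)
qed

text \<open>Justifies the definite description: \<open>skew_remainder\<close> supplies existence,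
  and symmetrizing the equation of any other candidate reduces uniqueness to
  \<open>stable_W_unique\<close>.\<close>

lemma fst_stable_point: "fst (stable_point Sig g M) = stable_W Sig g M"
proof -
  define P where "P = M - 2 *\<^sub>R (Sig ** stable_W Sig g M ** diagM g)"
  have "stable_point Sig g M = (stable_W Sig g M, P)"
    unfolding stable_point_def
  proof (rule the_equality)
    show "case (stable_W Sig g M, P) of (W, P) \<Rightarrow> transpose W = W \<and> transpose P = - P \<and>
        M - P = 2 *\<^sub>R (Sig ** W ** diagM g)"
      using skew_remainder[of M] by (simp add: P_def transpose_stable_W)
  next
    fix WP
    assume "case WP of (W, P) \<Rightarrow> transpose W = W \<and> transpose P = - P \<and>
        M - P = 2 *\<^sub>R (Sig ** W ** diagM g)"
    then obtain W Q where WP: "WP = (W, Q)" "transpose W = W" "transpose Q = - Q"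
      "M - Q = 2 *\<^sub>R (Sig ** W ** diagM g)"
      by (cases WP) auto
    have half: "Sig ** W ** diagM g = (1/2) *\<^sub>R (M - Q)"
      by (simp add: WP(4))
    have "transpose (M - Q) = transpose M - transpose Q"
      by (simp add: transpose_def vec_eq_iff)
    then have "transpose (M - Q) = transpose M + Q"
      by (simp add: WP(3))
    then have "Sig ** W ** diagM g + transpose (Sig ** transpose W ** diagM g)
        = (1/2) *\<^sub>R (M - Q) + (1/2) *\<^sub>R (transpose M + Q)"
      unfolding WP(2) half transpose_scalar by (rule arg_cong)
    also have "\<dots> = (1/2) *\<^sub>R (M + transpose M)"
      by (simp add: vec_eq_iff field_simps)
    finally have "W = stable_W Sig g M"
      by (rule stable_W_unique)
    moreover have "Q = M - 2 *\<^sub>R (Sig ** W ** diagM g)"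
      using WP(4) by (simp add: algebra_simps)
    ultimately show "WP = (stable_W Sig g M, P)"
      by (simp add: WP(1) P_def)
  qed
  then show ?thesis by simp
qed

section \<open>Expected utility and its first-order condition\<close>

abbreviation A where "A k \<equiv> blockM (Lmat Sig g) k k"

lemma block_energy:
  "2 * g $ k * ((A k *v h) \<bullet> (Sig *v (A k *v h))) \<le> h \<bullet> (A k *v h)"
proof -
  \<comment> \<open>Reporting only column k isolates the diagonal block: \<open>col W k\<close>
    becomes \<open>A k *v h\<close>, and pairing with \<open>X\<close> sees only that
    column.\<close>
  define X where "X = colsM ((\<lambda>_. 0)(k := h))"
  define W where "W = stable_W Sig g X"
  have "col W k = (\<Sum>j\<in>UNIV. if j = k then A k *v h else 0)"
    unfolding W_def col_stable_W by (intro sum.cong) (auto simp: X_def)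
  then have colW: "col W k = A k *v h"
    by simp
  have "h \<bullet> (A k *v h) = W \<bullet> X"
  proof -
    have "W \<bullet> X = (\<Sum>i\<in>UNIV. \<Sum>j\<in>UNIV. if j = k then W $ i $ k * h $ i else 0)"
      unfolding inner_vec_def by (intro sum.cong) (auto simp: X_def colsM_def)
    also have "\<dots> = h \<bullet> col W k"
      by (simp add: inner_vec_def col_def mult.commute)
    finally show ?thesis by (simp add: colW)
  qed
  \<comment> \<open>The split exposes the skew part of the stable point equation, which is
    orthogonal to the symmetric \<open>W\<close>.\<close>
  also have "\<dots> = W \<bullet> (X - 2 *\<^sub>R (Sig ** W ** diagM g)) + 2 * (W \<bullet> (Sig ** W ** diagM g))"
    by (simp add: inner_diff_right)
  also have "\<dots> = 2 * (\<Sum>j\<in>UNIV. g $ j * (col W j \<bullet> (Sig *v col W j)))"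
    using inner_skew_eq_0[of W "X - 2 *\<^sub>R (Sig ** W ** diagM g)"] skew_remainder[of X]
    by (simp add: W_def transpose_stable_W inner_mult_diagM)
  also have "\<dots> \<ge> 2 * (g $ k * (col W k \<bullet> (Sig *v col W k)))"
    by (intro mult_left_mono member_le_sum mult_nonneg_nonneg Sig_nonneg less_imp_le[OF g_pos])
      simp_all
  finally show ?thesis by (simp add: colW mult.assoc)
qed

lemma col_stable_W_update:
  "col (stable_W Sig g (M + colsM (delta(k := d)))) k
    = col (stable_W Sig g M) k + (A k *v d + (\<Sum>j\<in>-{k}. blockM (Lmat Sig g) k j *v delta j))"
proof -
  have "(\<Sum>j\<in>UNIV. blockM (Lmat Sig g) k j *v (delta(k := d)) j)
      = A k *v d + (\<Sum>j\<in>UNIV - {k}. blockM (Lmat Sig g) k j *v (delta(k := d)) j)"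
    by (subst sum.remove[of _ k]) auto
  also have "(\<Sum>j\<in>UNIV - {k}. blockM (Lmat Sig g) k j *v (delta(k := d)) j)
      = (\<Sum>j\<in>-{k}. blockM (Lmat Sig g) k j *v delta j)"
    by (intro sum.cong) auto
  finally show ?thesis
    by (simp add: linear_add[OF linear_stable_W] linear_add[OF linear_col]
        col_stable_W[of _ _ "colsM _"])
qed

text \<open>The contract column is \<open>b d + u M\<close>, where only \<open>u M\<close> is random
  and \<open>u\<close> is linear. Hence the mean enters only through \<open>v\<close>, and the
  second moment only through a constant independent of \<open>d\<close>.\<close>

lemma exp_utility_eq:
  fixes k :: 'n and delta :: "'n \<Rightarrow> real^'n" and d :: "real^'n"
  assumes "prob_space D" and D: "sets D = sets borel"
    and mom1: "integrable D (\<lambda>M. norm M)" and mom2: "integrable D (\<lambda>M. (norm M)\<^sup>2)"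
  defines "v \<equiv> col (Vmat Sig g D) k" and "u \<equiv> \<lambda>M. col (stable_W Sig g M) k"
  defines "b \<equiv> \<lambda>d. A k *v d + (\<Sum>j\<in>-{k}. blockM (Lmat Sig g) k j *v delta j)"
  shows "exp_utility Sig g D k delta d = - (d \<bullet> (b d + v))
    + g $ k * (b d \<bullet> (Sig *v b d) + 2 * (b d \<bullet> (Sig *v v))) + g $ k * (\<integral>M. u M \<bullet> (Sig *v u M) \<partial>D)"
proof -
  interpret prob_space D by fact
  have u: "linear u"
    using linear_compose[OF linear_stable_W linear_col] by (simp add: u_def[abs_def] o_def)
  have id: "integrable D (\<lambda>M. M)"
    using mom1 by (subst (asm) integrable_norm_iff) (auto simp: measurable_cong_sets[OF D refl])
  have int_u: "integrable D u" and E_u: "(\<integral>M. u M \<partial>D) = v"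
    using integrable_bounded_linear[OF linear_conv_bounded_linear[THEN iffD1, OF u] id]
      integral_bounded_linear[OF linear_conv_bounded_linear[THEN iffD1, OF u] id]
    by (simp_all add: v_def Vmat_eq u_def)
  have int_uu: "integrable D (\<lambda>M. u M \<bullet> (Sig *v u M))"
    using integrable_quadratic[OF D mom2 u matrix_vector_mul_linear u] .
  have w: "col (fst (stable_point Sig g (M + colsM (delta(k := d))))) k = b d + u M" for M
    by (simp add: fst_stable_point col_stable_W_update u_def b_def)
  have "(let w = col (fst (stable_point Sig g (M + colsM (delta(k := d))))) k in
            - (d \<bullet> w) + g $ k * (w \<bullet> (Sig *v w)))
      = (- (d \<bullet> b d) + g $ k * (b d \<bullet> (Sig *v b d)))
        + (2 * g $ k * ((Sig *v b d) \<bullet> u M) - d \<bullet> u M) + g $ k * (u M \<bullet> (Sig *v u M))" for M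
    unfolding w Let_def using Sig_commute[of "b d" "u M"]
    by (simp add: matrix_vector_right_distrib inner_add_left inner_add_right
        inner_commute[of "Sig *v b d"] algebra_simps)
  then have "exp_utility Sig g D k delta d
      = (- (d \<bullet> b d) + g $ k * (b d \<bullet> (Sig *v b d)))
        + (2 * g $ k * ((Sig *v b d) \<bullet> v) - d \<bullet> v) + g $ k * (\<integral>M. u M \<bullet> (Sig *v u M) \<partial>D)"
    unfolding exp_utility_def using int_u int_uu by (simp add: E_u prob_space)
  then show ?thesis
    using Sig_commute[of "b d" v] by (simp add: inner_add_right inner_commute algebra_simps)
qed

lemma best_response_iff:
  assumes "prob_space D" "sets D = sets borel"
    "integrable D (\<lambda>M. norm M)" "integrable D (\<lambda>M. (norm M)\<^sup>2)"
    and delta: "\<And>j. j \<notin> S \<Longrightarrow> delta j = 0"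
  shows "best_response Sig g D k delta (delta k) \<longleftrightarrow> fo_condition Sig g D S k delta"
proof -
  define d where "d = delta k"
  define v where "v = col (Vmat Sig g D) k"
  define c where "c = (\<Sum>j\<in>-{k}. blockM (Lmat Sig g) k j *v delta j)"
  define a where "a = A k *v d + c"
  \<comment> \<open>The gradient of the expected utility at \<open>d\<close>, where
    \<open>a + v\<close> is the expected contract column; the last term comes from differentiating
    that column inside its pairing with the report.\<close>
  define G where "G = (2 * g $ k) *\<^sub>R (transpose (A k) *v (Sig *v (a + v)))
    - (a + v) - transpose (A k) *v d"
  \<comment> \<open>Half the quadratic form of \<open>Tblk Sig g k k\<close>.\<close>
  define Q where "Q h = h \<bullet> (A k *v h) - g $ k * ((A k *v h) \<bullet> (Sig *v (A k *v h)))" for h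
  have adj: "x \<bullet> (y v* A k) = (A k *v x) \<bullet> y" for x y
    by (metis dot_lmul_matrix inner_commute)
  have "exp_utility Sig g D k delta (d + h) = exp_utility Sig g D k delta d + G \<bullet> h - Q h" for h
  proof -
    have report: "A k *v (d + h) + c = a + A k *v h" "A k *v d + c = a"
      by (simp_all add: a_def matrix_vector_right_distrib)
    have "G \<bullet> h = 2 * g $ k * ((A k *v h) \<bullet> (Sig *v a) + (A k *v h) \<bullet> (Sig *v v))
        - h \<bullet> a - h \<bullet> v - d \<bullet> (A k *v h)"
      by (simp add: G_def inner_commute[of _ h] inner_diff_right inner_add_right adj
          matrix_vector_right_distrib inner_commute[of _ d])
    then show ?thesis
      unfolding exp_utility_eq[OF assms(1-4)] v_def[symmetric] c_def[symmetric] report Q_def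
      using Sig_commute[of a "A k *v h"]
      by (simp add: matrix_vector_right_distrib inner_add_left inner_add_right algebra_simps)
  qed
  moreover have "0 \<le> Q h" for h
  proof -
    have "0 \<le> g $ k * ((A k *v h) \<bullet> (Sig *v (A k *v h)))"
      by (intro mult_nonneg_nonneg Sig_nonneg less_imp_le[OF g_pos])
    then show ?thesis using block_energy[of k h] by (simp add: Q_def)
  qed
  moreover have "Q (r *\<^sub>R h) = r\<^sup>2 * Q h" for r h
    by (simp add: Q_def matrix_vector_mult_scaleR power2_eq_square algebra_simps)
  ultimately have "best_response Sig g D k delta (delta k) \<longleftrightarrow> G = 0"
    unfolding best_response_def d_def[symmetric] by (rule quadratic_max_iff)
  also have "\<dots> \<longleftrightarrow> fo_condition Sig g D S k delta"
  proof -
    \<comment> \<open>The common factor of the condition: the off-diagonal blocks are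
      \<open>?N\<close> times blocks of \<open>Lmat\<close>, the diagonal one is
      \<open>?N ** A k + transpose (A k)\<close>, and the coefficient of \<open>v\<close> is
      \<open>- ?N\<close>.\<close>
    let ?N = "mat 1 - (2 * g $ k) *\<^sub>R (transpose (A k) ** Sig)"
    have N: "?N *v x = x - (2 * g $ k) *\<^sub>R (transpose (A k) *v (Sig *v x))" for x
      by (simp add: matrix_vector_mult_diff_rdistrib scaleR_matrix_vector_assoc[symmetric]
          matrix_vector_mul_assoc[symmetric])
    \<comment> \<open>Columns outside \<open>S\<close> are zero, so the sum extends to all agents
      other than \<open>k\<close>, as in \<open>c\<close>.\<close>
    have "(\<Sum>j\<in>S - {k}. Tblk Sig g k j *v delta j) = (\<Sum>j\<in>-{k}. Tblk Sig g k j *v delta j)"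
      by (intro sum.mono_neutral_left) (auto, metis delta matrix_vector_mult_0_right)
    also have "\<dots> = (\<Sum>j\<in>-{k}. ?N *v (blockM (Lmat Sig g) k j *v delta j))"
      by (intro sum.cong) (auto simp: Tblk_def Let_def matrix_vector_mul_assoc)
    also have "\<dots> = ?N *v c"
      by (simp add: c_def linear_sum[OF matrix_vector_mul_linear])
    finally have sum: "(\<Sum>j\<in>S - {k}. Tblk Sig g k j *v delta j) = ?N *v c" .
    have "Tblk Sig g k k *v d = ?N *v (A k *v d) + transpose (A k) *v d"
      unfolding N by (simp add: Tblk_def Let_def matrix_vector_mult_diff_rdistrib
          matrix_vector_mult_add_rdistrib scaleR_matrix_vector_assoc[symmetric]
          matrix_vector_mul_assoc[symmetric])
    moreover have "((2 * g $ k) *\<^sub>R (transpose (A k) ** Sig) - mat 1) *v v = - (?N *v v)"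
      by (simp add: matrix_vector_mult_diff_rdistrib)
    ultimately have "fo_condition Sig g D S k delta \<longleftrightarrow>
        ?N *v (A k *v d) + transpose (A k) *v d + ?N *v c = - (?N *v v)"
      unfolding fo_condition_def by (simp add: sum d_def[symmetric] v_def[symmetric])
    \<comment> \<open>Collected on one side, the equation is
      \<open>?N *v (a + v) + transpose (A k) *v d = 0\<close>, whose left side is
      \<open>- G\<close>.\<close>
    also have "\<dots> \<longleftrightarrow> - G = 0"
      unfolding N G_def a_def
      by (simp add: matrix_vector_right_distrib scaleR_add_right
          eq_neg_iff_add_eq_0 algebra_simps)
    finally show ?thesis by simp
  qed
  finally show ?thesis .
qed

end

theorem mainTheorem9:
  fixes Sig :: "real^'n^'n" and g :: "real^'n" and S :: "'n set"
    and D :: "'n \<Rightarrow> (real^'n^'n) measure"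
  assumes Sig: "pos_def_sym Sig"
    and g_pos: "\<forall>i. g $ i > 0"
    and D_prob: "\<forall>k\<in>S. prob_space (D k) \<and> sets (D k) = sets borel"
    and D_mom1: "\<forall>k\<in>S. integrable (D k) (\<lambda>M. norm M)"
    and D_mom2: "\<forall>k\<in>S. integrable (D k) (\<lambda>M. (norm M)\<^sup>2)"
  shows
    "(\<forall>k\<in>S. \<forall>delta. (\<forall>j. j \<notin> S \<longrightarrow> delta j = 0) \<longrightarrow>
        (best_response Sig g (D k) k delta (delta k) \<longleftrightarrow> fo_condition Sig g (D k) S k delta))
     \<and> (\<forall>Delta. (\<forall>j. j \<notin> S \<longrightarrow> col Delta j = 0) \<longrightarrow>
        (nash_eq Sig g D S Delta \<longleftrightarrow> (\<forall>k\<in>S. fo_condition Sig g (D k) S k (col Delta))))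
     \<and> ((\<not> (\<exists>delta. (\<forall>j. j \<notin> S \<longrightarrow> delta j = 0) \<and> (\<forall>k\<in>S. fo_condition Sig g (D k) S k delta)))
        \<longrightarrow> \<not> (\<exists>Delta. (\<forall>j. j \<notin> S \<longrightarrow> col Delta j = 0) \<and> nash_eq Sig g D S Delta))"
proof -
  interpret market Sig g
    using Sig g_pos by unfold_locales auto
  have "best_response Sig g (D k) k delta (delta k) \<longleftrightarrow> fo_condition Sig g (D k) S k delta"
    if "k \<in> S" "\<forall>j. j \<notin> S \<longrightarrow> delta j = 0" for k delta
    using best_response_iff[of "D k" S delta k] that D_prob D_mom1 D_mom2 by blast
  \<comment> \<open>Taking \<open>delta\<close> to be \<open>col Delta\<close> for every agent at
    once gives the Nash characterization, and its contrapositive gives nonexistence.\<close>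
  then show ?thesis
    unfolding nash_eq_def by blast
qed

end
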